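(* Consider the mixed-integer formulation described in the context. In this formulation the capacity limitation is enforced by constraints (F10) and (F11): for any assignment of the variables satisfying all constraints (F2)–(F12), every truck $t\in T$ satisfies the capacity limitation, i.e., at any time along its route $S_t$ the total volume of cargo carried by truck $t$ (the sum of $q_r$ over the requests $r\in D_t$ whose loading point $f(r)$ has already been visited by $t$ and whose unloading point $g(r)$ has not yet been visited) does not exceed $c^t$.
   Context: Profit-maximizing multi-vehicle pickup and delivery selection problem (location-based model). $V$ is a finite set of locations containing a depot $0$; $|V|$ denotes its cardinality. $T$ is a finite set of trucks, truck $t$ having capacity $c^t$ and arc costs $l^t_{od}$ ($o,d\in V$). $R$ is a finite set of requests; each $r\in R$ has a payment $w_r$, a volume $q_r$, a loading point $f(r)\in V\setminus\{0\}$ and an unloading point $g(r)\in V\setminus\{0\}$. Variables: $x^t_{od}$ ($t\in T$, $o,d\in V$; 1 iff truck $t$ traverses arc $(o,d)$), $y^t_r$ ($t\in T$, $r\in R$; 1 iff request $r$ is assigned to truck $t$), integers $u^t_v$ and $h^t_v$ ($t\in T$, $v\in V\setminus\{0\}$). Write $D_t=\{r: y^t_r=1\}$ and $S_t=\{(o,d): x^t_{od}=1\}$. The formulation maximizes $\sum_{r\in R}\sum_{t\in T}w_r y^t_r-\sum_{t\in T}\sum_{o,d\in V}l^t_{od}x^t_{od}$ subject to: (F2) $x^t_{od},y^t_r\in\{0,1\}$; (F3) $\sum_{t\in T}y^t_r\le 1$ for all $r$; (F4) $y^t_r\le\sum_{o\neq f(r)}x^t_{of(r)}$ for all $t,r$;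 (F5) $y^t_r\le\sum_{o\neq g(r)}x^t_{og(r)}$ for all $t,r$; (F6) $\sum_{d\in V}x^t_{od}-\sum_{d\in V}x^t_{do}=0$ for all $t$, $o\in V$; (F7) $\sum_{d\neq o}x^t_{od}\le 1$ for all $t$, $o\in V$; (F8) $u^t_d-u^t_o\ge 1-|V|(1-x^t_{od})$ for all $t$, $o,d\in V\setminus\{0\}$, $o\neq d$; (F9) $u^t_{f(r)}-u^t_{g(r)}<|V|(1-y^t_r)$ for all $t,r$; (F10) $\Gamma-M(1-x^t_{od})\le h^t_d-h^t_o\le\Gamma+M(1-x^t_{od})$ for all $t$, $o,d\in V\setminus\{0\}$, $o\neq d$, where $\Gamma=\sum_{r:\,f(r)=d}q_r y^t_r-\sum_{r:\,g(r)=d}q_r y^t_r$ and $M=c^t+\sum_{r\in R}q_r$; (F11) $0\le h^t_v\le c^t$ for all $t$, $v\in V\setminus\{0\}$; (F12) $0\le u^t_v\le |V|-2$ for all $t$, $v\in V\setminus\{0\}$. *)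

theory Defs
  imports Complex_Main
begin

record ('v, 't, 'r) pd_instance =
  locations :: "'v set"
  depot :: 'v
  trucks :: "'t set"
  capacity :: "'t \<Rightarrow> real"
  arc_cost :: "'t \<Rightarrow> 'v \<Rightarrow> 'v \<Rightarrow> real"
  requests :: "'r set"
  payment :: "'r \<Rightarrow> real"
  vol :: "'r \<Rightarrow> real"
  load_pt :: "'r \<Rightarrow> 'v"
  unload_pt :: "'r \<Rightarrow> 'v"

abbreviation customers :: "('v, 't, 'r, 'z) pd_instance_scheme \<Rightarrow> 'v set"
  where "customers P \<equiv> locations P - {depot P}"

text \<open>
  Capacities are taken to be nonnegative; this matters only if the depot is the sole location,
  as otherwise the bounds on the load variables entail it. Nothing is assumed about the signs
  or integrality of the other numerical data.
\<close>

definition pd_wf :: "('v, 't, 'r) pd_instance \<Rightarrow> bool"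
  where "pd_wf P \<longleftrightarrow>
    finite (locations P) \<and> depot P \<in> locations P \<and>
    finite (trucks P) \<and> (\<forall>t\<in>trucks P. 0 \<le> capacity P t) \<and>
    finite (requests P) \<and>
    (\<forall>r\<in>requests P. load_pt P r \<in> customers P \<and> unload_pt P r \<in> customers P)"

record ('v, 't, 'r) pd_assignment =
  xv :: "'t \<Rightarrow> 'v \<Rightarrow> 'v \<Rightarrow> int"
  yv :: "'t \<Rightarrow> 'r \<Rightarrow> int"
  uv :: "'t \<Rightarrow> 'v \<Rightarrow> int"
  hv :: "'t \<Rightarrow> 'v \<Rightarrow> int"

text \<open>The objective to be maximized; feasibility does not depend on it.\<close>

definition objective :: "('v, 't, 'r) pd_instance \<Rightarrow> ('v, 't, 'r) pd_assignment \<Rightarrow> real"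
  where "objective P A =
    (\<Sum>r\<in>requests P. \<Sum>t\<in>trucks P. payment P r * of_int (yv A t r)) -
    (\<Sum>t\<in>trucks P. \<Sum>a\<in>locations P. \<Sum>b\<in>locations P. arc_cost P t a b * of_int (xv A t a b))"

definition binary_vars :: "('v, 't, 'r) pd_instance \<Rightarrow> ('v, 't, 'r) pd_assignment \<Rightarrow> bool"
  where "binary_vars P A \<longleftrightarrow>
    (\<forall>t\<in>trucks P. \<forall>a\<in>locations P. \<forall>b\<in>locations P. xv A t a b \<in> {0, 1}) \<and>
    (\<forall>t\<in>trucks P. \<forall>r\<in>requests P. yv A t r \<in> {0, 1})"

definition request_once :: "('v, 't, 'r) pd_instance \<Rightarrow> ('v, 't, 'r) pd_assignment \<Rightarrow> bool"
  where "request_once P A \<longleftrightarrow> (\<forall>r\<in>requests P. (\<Sum>t\<in>trucks P. yv A t r) \<le> 1)"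

definition visits_load_pt :: "('v, 't, 'r) pd_instance \<Rightarrow> ('v, 't, 'r) pd_assignment \<Rightarrow> bool"
  where "visits_load_pt P A \<longleftrightarrow> (\<forall>t\<in>trucks P. \<forall>r\<in>requests P.
    yv A t r \<le> (\<Sum>a\<in>locations P - {load_pt P r}. xv A t a (load_pt P r)))"

definition visits_unload_pt :: "('v, 't, 'r) pd_instance \<Rightarrow> ('v, 't, 'r) pd_assignment \<Rightarrow> bool"
  where "visits_unload_pt P A \<longleftrightarrow> (\<forall>t\<in>trucks P. \<forall>r\<in>requests P.
    yv A t r \<le> (\<Sum>a\<in>locations P - {unload_pt P r}. xv A t a (unload_pt P r)))"

definition flow_conservation :: "('v, 't, 'r) pd_instance \<Rightarrow> ('v, 't, 'r) pd_assignment \<Rightarrow> bool"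
  where "flow_conservation P A \<longleftrightarrow> (\<forall>t\<in>trucks P. \<forall>a\<in>locations P.
    (\<Sum>b\<in>locations P. xv A t a b) - (\<Sum>b\<in>locations P. xv A t b a) = 0)"

definition leaves_once :: "('v, 't, 'r) pd_instance \<Rightarrow> ('v, 't, 'r) pd_assignment \<Rightarrow> bool"
  where "leaves_once P A \<longleftrightarrow> (\<forall>t\<in>trucks P. \<forall>a\<in>locations P.
    (\<Sum>b\<in>locations P - {a}. xv A t a b) \<le> 1)"

definition visit_order :: "('v, 't, 'r) pd_instance \<Rightarrow> ('v, 't, 'r) pd_assignment \<Rightarrow> bool"
  where "visit_order P A \<longleftrightarrow> (\<forall>t\<in>trucks P. \<forall>a\<in>customers P. \<forall>b\<in>customers P. a \<noteq> b \<longrightarrow>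
    uv A t b - uv A t a \<ge> 1 - int (card (locations P)) * (1 - xv A t a b))"

definition load_before_unload :: "('v, 't, 'r) pd_instance \<Rightarrow> ('v, 't, 'r) pd_assignment \<Rightarrow> bool"
  where "load_before_unload P A \<longleftrightarrow> (\<forall>t\<in>trucks P. \<forall>r\<in>requests P.
    uv A t (load_pt P r) - uv A t (unload_pt P r) < int (card (locations P)) * (1 - yv A t r))"

definition Gam :: "('v, 't, 'r) pd_instance \<Rightarrow> ('v, 't, 'r) pd_assignment \<Rightarrow> 't \<Rightarrow> 'v \<Rightarrow> real"
  where "Gam P A t b =
    (\<Sum>r\<in>{r \<in> requests P. load_pt P r = b}. vol P r * of_int (yv A t r)) -
    (\<Sum>r\<in>{r \<in> requests P. unload_pt P r = b}. vol P r * of_int (yv A t r))"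

definition bigM :: "('v, 't, 'r) pd_instance \<Rightarrow> 't \<Rightarrow> real"
  where "bigM P t = capacity P t + (\<Sum>r\<in>requests P. vol P r)"

definition load_propagation :: "('v, 't, 'r) pd_instance \<Rightarrow> ('v, 't, 'r) pd_assignment \<Rightarrow> bool"
  where "load_propagation P A \<longleftrightarrow> (\<forall>t\<in>trucks P. \<forall>a\<in>customers P. \<forall>b\<in>customers P. a \<noteq> b \<longrightarrow>
    Gam P A t b - bigM P t * (1 - of_int (xv A t a b)) \<le> of_int (hv A t b) - of_int (hv A t a) \<and>
    of_int (hv A t b) - of_int (hv A t a) \<le> Gam P A t b + bigM P t * (1 - of_int (xv A t a b)))"

definition load_bounds :: "('v, 't, 'r) pd_instance \<Rightarrow> ('v, 't, 'r) pd_assignment \<Rightarrow> bool"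
  where "load_bounds P A \<longleftrightarrow> (\<forall>t\<in>trucks P. \<forall>v\<in>customers P.
    0 \<le> hv A t v \<and> of_int (hv A t v) \<le> capacity P t)"

definition order_bounds :: "('v, 't, 'r) pd_instance \<Rightarrow> ('v, 't, 'r) pd_assignment \<Rightarrow> bool"
  where "order_bounds P A \<longleftrightarrow> (\<forall>t\<in>trucks P. \<forall>v\<in>customers P.
    0 \<le> uv A t v \<and> uv A t v \<le> int (card (locations P)) - 2)"

definition feasible :: "('v, 't, 'r) pd_instance \<Rightarrow> ('v, 't, 'r) pd_assignment \<Rightarrow> bool"
  where "feasible P A \<longleftrightarrow>
    binary_vars P A \<and> request_once P A \<and> visits_load_pt P A \<and> visits_unload_pt P A \<and>
    flow_conservation P A \<and> leaves_once P A \<and> visit_order P A \<and>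
    load_before_unload P A \<and> load_propagation P A \<and> load_bounds P A \<and> order_bounds P A"

definition assigned :: "('v, 't, 'r) pd_instance \<Rightarrow> ('v, 't, 'r) pd_assignment \<Rightarrow> 't \<Rightarrow> 'r set"
  where "assigned P A t = {r \<in> requests P. yv A t r = 1}"

definition route_arcs ::
    "('v, 't, 'r) pd_instance \<Rightarrow> ('v, 't, 'r) pd_assignment \<Rightarrow> 't \<Rightarrow> ('v \<times> 'v) set"
  where "route_arcs P A t = {(a, b). a \<in> locations P \<and> b \<in> locations P \<and> xv A t a b = 1}"

text \<open>
  A travel history of truck \<open>t\<close>: the list of locations visited so far when the truck starts at
  the depot and moves along its selected arcs. Histories need not be complete tours, and they
  may use loops \<open>(v, v)\<close>, which the constraints do not exclude.
\<close>

definition travels :: "('v, 't, 'r) pd_instance \<Rightarrow> ('v, 't, 'r) pd_assignment \<Rightarrow> 't \<Rightarrow> 'v list \<Rightarrow> bool"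
  where "travels P A t vs \<longleftrightarrow>
    vs \<noteq> [] \<and> hd vs = depot P \<and> successively (\<lambda>a b. (a, b) \<in> route_arcs P A t) vs"

text \<open>The volume on board of truck \<open>t\<close> once exactly the locations in \<open>X\<close> have been visited.\<close>

definition carried ::
    "('v, 't, 'r) pd_instance \<Rightarrow> ('v, 't, 'r) pd_assignment \<Rightarrow> 't \<Rightarrow> 'v set \<Rightarrow> real"
  where "carried P A t X =
    (\<Sum>r\<in>{r \<in> assigned P A t. load_pt P r \<in> X \<and> unload_pt P r \<notin> X}. vol P r)"

definition capacity_respected ::
    "('v, 't, 'r) pd_instance \<Rightarrow> ('v, 't, 'r) pd_assignment \<Rightarrow> 't \<Rightarrow> bool"
  where "capacity_respected P A t \<longleftrightarrow>
    (\<forall>vs. travels P A t vs \<longrightarrow>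
      (\<forall>k<length vs. carried P A t (set (take (Suc k) vs)) \<le> capacity P t))"

end

(*
  Selected loops (v, v) change neither the flow balance nor the load constraints, so only proper
  arcs matter. By (F6) and (F7) the proper arcs form disjoint cycles, and by (F8) the values u
  increase along them away from the depot, so there is a single cycle and it runs through the depot.

  No constraint links the load variable h of the first customer to the actual cargo, hence summing
  (F10) forwards from the depot is not enough. Instead sum (F10) from the current location c to
  the last customer z of the tour: the net loads Gam of the customers not yet visited add up to
  h z - h c. Since every assigned request is loaded and unloaded on the tour, in this order, this
  sum is minus the volume on board. Hence the volume on board is h c - h z, which is at most the
  capacity by (F11).
*)
theory Submission
  imports Defs
begin

section \<open>Sums of binary integers\<close>

lemma binary_sum_pos_imp_ex:
  fixes f :: "'a \<Rightarrow> int"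
  assumes "0 < sum f S"
    and "\<And>i. i \<in> S \<Longrightarrow> f i \<in> {0, 1}"
  shows "\<exists>i\<in>S. f i = 1"
proof (rule ccontr)
  assume "\<not> ?thesis"
  then have "sum f S = 0"
    using assms(2) by (intro sum.neutral) blast
  then show False
    using assms(1) by simp
qed

lemma binary_sum_le_1_unique:
  fixes f :: "'a \<Rightarrow> int"
  assumes "finite S" "sum f S \<le> 1"
    and "\<And>i. i \<in> S \<Longrightarrow> f i \<in> {0, 1}"
    and "i \<in> S" "j \<in> S" "f i = 1" "f j = 1"
  shows "i = j"
proof (rule ccontr)
  assume "i \<noteq> j"
  then have "sum f {i, j} = 2"
    using assms by simp
  moreover have "sum f {i, j} \<le> sum f S"
    using assms by (intro sum_mono2) force+
  ultimately show False
    using assms(2) by simp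
qed

section \<open>Proper arcs and the constraints of one truck\<close>

locale feasible_truck =
  fixes P :: "('v, 't, 'r) pd_instance"
    and A :: "('v, 't, 'r) pd_assignment"
    and t :: 't
  assumes wf: "pd_wf P"
    and feas: "feasible P A"
    and truck: "t \<in> trucks P"
begin

definition arc :: "'v \<Rightarrow> 'v \<Rightarrow> bool"
  where "arc a b \<longleftrightarrow> (a, b) \<in> route_arcs P A t \<and> a \<noteq> b"

text \<open>Having an incoming proper arc is a local condition; that these customers are actually
  reached from the depot is derived later from \<open>u\<close>.\<close>

definition visited :: "'v set"
  where "visited = {v \<in> customers P. \<exists>a. arc a v}"

lemma finite_visited [simp]: "finite visited"
  using wf by (simp add: visited_def pd_wf_def)

lemma depot_not_visited: "depot P \<notin> visited"
  by (simp add: visited_def)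

lemma x_binary: "a \<in> locations P \<Longrightarrow> b \<in> locations P \<Longrightarrow> xv A t a b \<in> {0, 1}"
  using feas truck unfolding feasible_def binary_vars_def by blast

lemma y_binary: "r \<in> requests P \<Longrightarrow> yv A t r \<in> {0, 1}"
  using feas truck unfolding feasible_def binary_vars_def by blast

lemma arcI: "a \<in> locations P \<Longrightarrow> b \<in> locations P \<Longrightarrow> xv A t a b = 1 \<Longrightarrow> a \<noteq> b \<Longrightarrow> arc a b"
  by (simp add: arc_def route_arcs_def)

lemma arcD:
  assumes "arc a b"
  shows "a \<in> locations P" "b \<in> locations P" "xv A t a b = 1" "a \<noteq> b"
  using assms by (auto simp: arc_def route_arcs_def)

lemma arc_into_visited: "arc a b \<Longrightarrow> b \<noteq> depot P \<Longrightarrow> b \<in> visited"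
  by (auto simp: visited_def dest: arcD)

text \<open>The loop term \<open>xv A t v v\<close> occurs in both sums of
  \<open>flow_conservation\<close> and cancels.\<close>

lemma balance:
  assumes "v \<in> locations P"
  shows "(\<Sum>b\<in>locations P - {v}. xv A t v b) = (\<Sum>a\<in>locations P - {v}. xv A t a v)"
proof -
  have fin: "finite (locations P)"
    using wf by (simp add: pd_wf_def)
  have "(\<Sum>b\<in>locations P. xv A t v b) = (\<Sum>a\<in>locations P. xv A t a v)"
    using feas truck assms by (auto simp: feasible_def flow_conservation_def)
  then show ?thesis
    using assms fin by (simp add: sum.remove)
qed

lemma sum_in_pos:
  assumes "arc a v"
  shows "0 < (\<Sum>a\<in>locations P - {v}. xv A t a v)"
proof -
  have "xv A t a v \<le> (\<Sum>a\<in>locations P - {v}. xv A t a v)"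
    using assms wf arcD[OF assms] x_binary[of _ v]
    by (intro member_le_sum) (force simp: pd_wf_def)+
  then show ?thesis
    using arcD[OF assms] by simp
qed

lemma sum_in_pos_imp_arc:
  assumes "v \<in> locations P" "0 < (\<Sum>a\<in>locations P - {v}. xv A t a v)"
  shows "\<exists>a. arc a v"
  using binary_sum_pos_imp_ex[OF assms(2)] x_binary assms(1) by (blast intro: arcI)

lemma ex_arc_out:
  assumes "v \<in> visited"
  shows "\<exists>d. arc v d"
proof -
  obtain a where a: "arc a v"
    using assms by (auto simp: visited_def)
  have v: "v \<in> locations P"
    using arcD[OF a] by simp
  have "0 < (\<Sum>b\<in>locations P - {v}. xv A t v b)"
    using sum_in_pos[OF a] balance[OF v] by simp
  then show ?thesis
    using binary_sum_pos_imp_ex[of "\<lambda>b. xv A t v b"] x_binary v by (blast intro: arcI)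
qed

lemma arc_out_unique:
  assumes "arc a b" "arc a c"
  shows "b = c"
proof (rule binary_sum_le_1_unique[where f = "\<lambda>b. xv A t a b"])
  show "finite (locations P - {a})"
    using wf by (simp add: pd_wf_def)
  show "(\<Sum>b\<in>locations P - {a}. xv A t a b) \<le> 1"
    using feas truck arcD(1)[OF assms(1)] by (simp add: feasible_def leaves_once_def)
  show "\<And>i. i \<in> locations P - {a} \<Longrightarrow> xv A t a i \<in> {0, 1}"
    using x_binary arcD(1)[OF assms(1)] by blast
qed (use arcD[OF assms(1)] arcD[OF assms(2)] in auto)

lemma u_increasing:
  assumes "arc a b" "a \<noteq> depot P" "b \<noteq> depot P"
  shows "uv A t a < uv A t b"
proof -
  have ends: "a \<in> customers P" "b \<in> customers P"
    using assms arcD[OF assms(1)] by auto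
  have "uv A t b - uv A t a \<ge> 1 - int (card (locations P)) * (1 - xv A t a b)"
    using feas truck arcD(4)[OF assms(1)] ends unfolding feasible_def visit_order_def by blast
  then show ?thesis
    using arcD(3)[OF assms(1)] by simp
qed

text \<open>On a selected arc the factor of \<open>bigM\<close> is zero, so the two inequalities of
  \<open>load_propagation\<close> meet, whatever the sign of \<open>bigM\<close>.\<close>

lemma h_step:
  assumes "arc a b" "a \<noteq> depot P" "b \<noteq> depot P"
  shows "of_int (hv A t b) - of_int (hv A t a) = Gam P A t b"
proof -
  have ends: "a \<in> customers P" "b \<in> customers P"
    using assms arcD[OF assms(1)] by auto
  have "Gam P A t b - bigM P t * (1 - of_int (xv A t a b)) \<le> of_int (hv A t b) - of_int (hv A t a)"
    "of_int (hv A t b) - of_int (hv A t a) \<le> Gam P A t b + bigM P t * (1 - of_int (xv A t a b))"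
    using feas truck arcD(4)[OF assms(1)] ends unfolding feasible_def load_propagation_def by blast+
  then show ?thesis
    using arcD(3)[OF assms(1)] by simp
qed

lemma h_bounds:
  assumes "v \<in> visited"
  shows "0 \<le> hv A t v" "of_int (hv A t v) \<le> capacity P t"
  using feas truck assms by (auto simp: feasible_def load_bounds_def visited_def)

lemma arc_source_visited:
  assumes "arc a b" "a \<noteq> depot P"
  shows "a \<in> visited"
proof -
  have a: "a \<in> locations P"
    using arcD[OF assms(1)] by simp
  have "xv A t a b \<le> (\<Sum>b\<in>locations P - {a}. xv A t a b)"
    using arcD[OF assms(1)] wf x_binary[of a]
    by (intro member_le_sum) (force simp: pd_wf_def)+
  then have "0 < (\<Sum>a'\<in>locations P - {a}. xv A t a' a)"
    using arcD(3)[OF assms(1)] balance[OF a] by simp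
  then show ?thesis
    using sum_in_pos_imp_arc[OF a] a assms(2) by (simp add: visited_def)
qed

text \<open>Going backwards from \<open>v\<close> lowers \<open>u\<close>, so it must reach the depot and hence enter \<open>X\<close>.\<close>

lemma crossing_arc:
  assumes "v \<in> visited" "v \<notin> X" "depot P \<in> X"
  shows "\<exists>a\<in>X. \<exists>b. arc a b \<and> b \<in> visited - X \<and> uv A t b \<le> uv A t v"
  using assms(1,2)
proof (induction "nat (uv A t v)" arbitrary: v rule: less_induct)
  case less
  obtain a where a: "arc a v"
    using less.prems by (auto simp: visited_def)
  have v: "v \<noteq> depot P"
    using less.prems by (auto simp: visited_def)
  show ?case
  proof (cases "a \<in> X")
    case True
    then show ?thesis
      using a less.prems by blast
  next
    case False
    then have "a \<noteq> depot P"
      using assms(3) by blast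
    then have av: "a \<in> visited" and u: "uv A t a < uv A t v"
      using a v by (auto intro: arc_source_visited u_increasing)
    \<comment> \<open>This lower bound is what turns the decrease of \<open>u\<close> into a
      decrease of the \<open>nat\<close> measure.\<close>
    have "0 \<le> uv A t a"
      using av feas truck by (auto simp: feasible_def order_bounds_def visited_def)
    then have "nat (uv A t a) < nat (uv A t v)"
      using u by simp
    from less.hyps[OF this av False] show ?thesis
      using u by force
  qed
qed

text \<open>A visited customer outside \<open>X\<close> would yield, by \<open>crossing_arc\<close>,
  an arc leaving \<open>X\<close>.\<close>

lemma closed_contains_visited:
  assumes "depot P \<in> X" "\<And>a b. a \<in> X \<Longrightarrow> arc a b \<Longrightarrow> b \<in> X"
  shows "visited \<subseteq> X"
  using crossing_arc[of _ X] assms by blast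

section \<open>Cargo expressed through net loads\<close>

lemma assigned_points:
  assumes "r \<in> assigned P A t"
  shows "load_pt P r \<in> visited" "unload_pt P r \<in> visited"
    "uv A t (load_pt P r) \<le> uv A t (unload_pt P r)"
proof -
  have r: "r \<in> requests P" "yv A t r = 1"
    using assms by (auto simp: assigned_def)
  have c: "load_pt P r \<in> customers P" "unload_pt P r \<in> customers P"
    using wf r by (auto simp: pd_wf_def)
  have "0 < (\<Sum>a\<in>locations P - {load_pt P r}. xv A t a (load_pt P r))"
    using feas truck r by (force simp: feasible_def visits_load_pt_def)
  then show "load_pt P r \<in> visited"
    using sum_in_pos_imp_arc c by (simp add: visited_def)
  have "0 < (\<Sum>a\<in>locations P - {unload_pt P r}. xv A t a (unload_pt P r))"
    using feas truck r by (force simp: feasible_def visits_unload_pt_def)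
  then show "unload_pt P r \<in> visited"
    using sum_in_pos_imp_arc c by (simp add: visited_def)
  have "uv A t (load_pt P r) - uv A t (unload_pt P r)
      < int (card (locations P)) * (1 - yv A t r)"
    using feas truck r(1) unfolding feasible_def load_before_unload_def by blast
  then show "uv A t (load_pt P r) \<le> uv A t (unload_pt P r)"
    using r by simp
qed

text \<open>After swapping the sums, each request is counted only at its point \<open>p r\<close>.
  The lemma is used with \<open>p\<close> as the loading and as the unloading point.\<close>

lemma sum_at_points:
  assumes "finite S"
  shows "(\<Sum>v\<in>S. \<Sum>r\<in>{r \<in> requests P. p r = v}. vol P r * of_int (yv A t r))
    = (\<Sum>r\<in>assigned P A t. if p r \<in> S then vol P r else 0)"
proof -
  have fin: "finite (requests P)"
    using wf by (simp add: pd_wf_def)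
  have "(\<Sum>v\<in>S. \<Sum>r\<in>{r \<in> requests P. p r = v}. vol P r * of_int (yv A t r))
      = (\<Sum>v\<in>S. \<Sum>r\<in>requests P. if p r = v then vol P r * of_int (yv A t r) else 0)"
    using fin by (simp add: sum.inter_filter)
  also have "\<dots> = (\<Sum>r\<in>requests P. \<Sum>v\<in>S. if p r = v then vol P r * of_int (yv A t r) else 0)"
    by (rule sum.swap)
  also have "\<dots> = (\<Sum>r\<in>requests P. if p r \<in> S then vol P r * of_int (yv A t r) else 0)"
    using assms by simp
  also have "\<dots> = (\<Sum>r\<in>requests P.
      if yv A t r = 1 then (if p r \<in> S then vol P r else 0) else 0)"
    using y_binary by (intro sum.cong) force+
  also have "\<dots> = (\<Sum>r\<in>assigned P A t. if p r \<in> S then vol P r else 0)"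
    using fin by (simp add: assigned_def sum.inter_filter)
  finally show ?thesis .
qed

lemma carried_eq_remaining:
  assumes "\<And>r. r \<in> assigned P A t \<Longrightarrow> unload_pt P r \<in> X \<Longrightarrow> load_pt P r \<in> X"
  shows "carried P A t X = - (\<Sum>v\<in>visited - X. Gam P A t v)"
proof -
  have fin: "finite (assigned P A t)"
    using wf by (simp add: pd_wf_def assigned_def)
  have "carried P A t X
      = (\<Sum>r\<in>assigned P A t. if load_pt P r \<in> X \<and> unload_pt P r \<notin> X then vol P r else 0)"
    unfolding carried_def using fin by (rule sum.inter_filter)
  also have "\<dots> = (\<Sum>r\<in>assigned P A t. (if unload_pt P r \<in> visited - X then vol P r else 0)
      - (if load_pt P r \<in> visited - X then vol P r else 0))"
    \<comment> \<open>If both points lie outside \<open>X\<close> the two terms cancel; if only the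
      unloading point does, the request is on board. The remaining case, which would contribute a
      negative volume, is excluded by the assumption.\<close>
    using assms assigned_points by (intro sum.cong) auto
  also have "\<dots> = - (\<Sum>v\<in>visited - X. Gam P A t v)"
    unfolding Gam_def by (simp add: sum_subtractf sum_at_points)
  finally show ?thesis .
qed

section \<open>The truck on its way between leaving the depot and returning\<close>

text \<open>
  \<open>X\<close> is the set of locations seen when the truck has left the depot, has not yet returned, and
  is at \<open>c\<close>.
\<close>

definition on_tour :: "'v set \<Rightarrow> 'v \<Rightarrow> bool"
  where "on_tour X c \<longleftrightarrow> depot P \<in> X \<and> c \<in> visited \<and> c \<in> X \<and>
    (\<forall>a\<in>X - {c}. \<forall>b. arc a b \<longrightarrow> b \<in> X) \<and> (\<forall>v\<in>X \<inter> visited. uv A t v \<le> uv A t c)"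

text \<open>\<open>u\<close> is largest at \<open>c\<close> among the visited customers in
  \<open>X\<close> and rises along the arc, so \<open>d\<close> is new. Adding it closes the only
  gap, since \<open>c\<close> has no other successor.\<close>

lemma on_tour_step:
  assumes tour: "on_tour X c" and arc: "arc c d" and d: "d \<noteq> depot P"
  shows "on_tour (insert d X) d" "d \<notin> X"
proof -
  have u: "uv A t c < uv A t d"
    using tour arc d depot_not_visited by (intro u_increasing) (auto simp: on_tour_def)
  have dv: "d \<in> visited"
    using arc d by (rule arc_into_visited)
  show "d \<notin> X"
  proof
    assume "d \<in> X"
    then have "uv A t d \<le> uv A t c"
      using tour dv unfolding on_tour_def by blast
    then show False
      using u by simp
  qed
  show "on_tour (insert d X) d"
    unfolding on_tour_def
  proof (intro conjI ballI allI impI)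
    fix a b
    assume "a \<in> insert d X - {d}" "arc a b"
    then show "b \<in> insert d X"
      using tour arc_out_unique[OF arc] unfolding on_tour_def by blast
  next
    fix v
    assume "v \<in> insert d X \<inter> visited"
    then have "v = d \<or> uv A t v \<le> uv A t c"
      using tour unfolding on_tour_def by blast
    then show "uv A t v \<le> uv A t d"
      using u by auto
  qed (use tour dv in \<open>auto simp: on_tour_def\<close>)
qed

text \<open>Only \<open>c\<close> could have a successor outside \<open>X\<close>, and its unique
  successor is the depot, so \<open>X\<close> is closed under arcs.\<close>

lemma on_tour_return:
  assumes "on_tour X c" "arc c (depot P)"
  shows "visited \<subseteq> X"
proof (rule closed_contains_visited)
  fix a b
  assume "a \<in> X" "arc a b"
  then show "b \<in> X"
    using assms(1) arc_out_unique[OF assms(2)] unfolding on_tour_def by blast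
qed (use assms in \<open>simp add: on_tour_def\<close>)

text \<open>Telescoping \<open>h_step\<close> over the customers still ahead turns the right-hand
  side into \<open>h\<close> at the last customer, which is nonnegative. The induction is on the
  number of customers ahead.\<close>

lemma remaining_bound:
  assumes "on_tour X c"
  shows "0 \<le> of_int (hv A t c) + (\<Sum>v\<in>visited - X. Gam P A t v)"
  using assms
proof (induction "card (visited - X)" arbitrary: X c rule: less_induct)
  case less
  have c: "c \<in> visited" "c \<noteq> depot P"
    using less.prems depot_not_visited by (auto simp: on_tour_def)
  obtain d where d: "arc c d"
    using ex_arc_out c by blast
  show ?case
  proof (cases "d = depot P")
    case True
    then have "visited - X = {}"
      using on_tour_return less.prems d by blast
    then show ?thesis
      using h_bounds(1)[OF c(1)] by (simp only: sum.empty)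
  next
    case False
    note step = on_tour_step[OF less.prems d False]
    have "d \<in> visited - X"
      using step by (auto simp: on_tour_def)
    then have eq: "visited - X = insert d (visited - insert d X)"
      by blast
    have card: "card (visited - insert d X) < card (visited - X)"
      using \<open>d \<in> visited - X\<close> by (intro psubset_card_mono) auto
    have "(\<Sum>v\<in>visited - X. Gam P A t v) = Gam P A t d + (\<Sum>v\<in>visited - insert d X. Gam P A t v)"
      by (subst eq) simp
    then show ?thesis
      using less.hyps[OF card step(1)] h_step[OF d c(2) False] by linarith
  qed
qed

lemma on_tour_carried:
  assumes "on_tour X c"
  shows "carried P A t X \<le> capacity P t"
proof -
  \<comment> \<open>An arc crossing out of \<open>X\<close> must start at \<open>c\<close>, so
    \<open>u\<close> at its head exceeds \<open>u\<close> at \<open>c\<close>, and \<open>v\<close>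
    has at least that value.\<close>
  have later: "uv A t c < uv A t v" if v: "v \<in> visited" "v \<notin> X" for v
  proof -
    obtain a b where ab: "a \<in> X" "arc a b" "b \<in> visited - X" "uv A t b \<le> uv A t v"
      using crossing_arc[OF v] assms by (auto simp: on_tour_def)
    have "a = c" "c \<noteq> depot P" "b \<noteq> depot P"
      using ab assms depot_not_visited unfolding on_tour_def by blast+
    then have "uv A t c < uv A t b"
      using u_increasing ab(2) by simp
    then show ?thesis
      using ab(4) by simp
  qed
  \<comment> \<open>Otherwise \<open>u\<close> at the loading point would exceed \<open>u\<close> at
    \<open>c\<close> and hence at the unloading point.\<close>
  have "load_pt P r \<in> X" if r: "r \<in> assigned P A t" "unload_pt P r \<in> X" for r
  proof (rule ccontr)
    assume "load_pt P r \<notin> X"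
    then have "uv A t c < uv A t (load_pt P r)"
      using later assigned_points(1)[OF r(1)] by blast
    moreover have "uv A t (unload_pt P r) \<le> uv A t c"
      using assms r assigned_points(2)[OF r(1)] by (auto simp: on_tour_def)
    ultimately show False
      using assigned_points(3)[OF r(1)] by simp
  qed
  then have "carried P A t X = - (\<Sum>v\<in>visited - X. Gam P A t v)"
    by (rule carried_eq_remaining)
  moreover have "c \<in> visited"
    using assms by (simp add: on_tour_def)
  ultimately show ?thesis
    using remaining_bound[OF assms] h_bounds(2)[of c] by linarith
qed

section \<open>Arbitrary travel histories\<close>

lemma travel_stages:
  assumes "travels P A t vs"
  shows "(set vs = {depot P} \<and> last vs = depot P) \<or> on_tour (set vs) (last vs) \<or> visited \<subseteq> set vs"
  using assms
proof (induction vs rule: rev_induct)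
  case Nil
  then show ?case
    by (simp add: travels_def)
next
  case (snoc d vs)
  show ?case
  proof (cases "vs = []")
    case True
    then show ?thesis
      using snoc.prems by (simp add: travels_def)
  next
    case False
    then have tr: "travels P A t vs" and d: "(last vs, d) \<in> route_arcs P A t"
      using snoc.prems by (auto simp: travels_def successively_append_iff)
    \<comment> \<open>A loop changes neither the set of seen locations nor the last one.\<close>
    have stay: ?thesis if "last vs = d"
      using snoc.IH[OF tr] that last_in_set[OF False] by (auto simp: insert_absorb)
    have move: ?thesis if arc: "arc (last vs) d"
      using snoc.IH[OF tr]
    proof (elim disjE conjE)
      assume eq: "set vs = {depot P}" "last vs = depot P"
      have "d \<in> visited"
        using arcD(4)[OF arc] arc_into_visited[OF arc] eq by simp
      \<comment> \<open>First departure: uniqueness of the arc out of the depot gives the closure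
        condition of \<open>on_tour\<close>.\<close>
      moreover have "b = d" if "arc (depot P) b" for b
        using arc_out_unique arc that eq by simp
      ultimately show ?thesis
        using eq depot_not_visited by (auto simp: on_tour_def)
    next
      assume tour: "on_tour (set vs) (last vs)"
      show ?thesis
      proof (cases "d = depot P")
        case True
        then show ?thesis
          using on_tour_return[OF tour] arc by auto
      next
        case False
        then show ?thesis
          using on_tour_step(1)[OF tour arc] by simp
      qed
    next
      \<comment> \<open>This stage is never left, so repeated tours need no further
        analysis.\<close>
      assume "visited \<subseteq> set vs"
      then show ?thesis
        by auto
    qed
    show ?thesis
      using stay move d by (auto simp: arc_def)
  qed
qed

text \<open>Before departure and after a full tour nothing is on board, so nonnegative capacity
  suffices; in between \<open>on_tour_carried\<close> applies.\<close>

lemma travel_carried: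
  assumes "travels P A t vs"
  shows "carried P A t (set vs) \<le> capacity P t"
proof -
  have nonneg: "0 \<le> capacity P t"
    using wf truck by (simp add: pd_wf_def)
  have empty: "carried P A t X = 0"
    if "\<And>r. r \<in> assigned P A t \<Longrightarrow> load_pt P r \<notin> X \<or> unload_pt P r \<in> X" for X
    unfolding carried_def using that by (intro sum.neutral) blast
  from travel_stages[OF assms] show ?thesis
  proof (elim disjE conjE)
    assume "set vs = {depot P}"
    then have "carried P A t (set vs) = 0"
      using assigned_points(1) depot_not_visited by (intro empty) (metis singletonD)
    then show ?thesis
      using nonneg by simp
  next
    assume "visited \<subseteq> set vs"
    then have "carried P A t (set vs) = 0"
      using assigned_points(2) by (intro empty) blast
    then show ?thesis
      using nonneg by simp
  qed (rule on_tour_carried)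
qed

lemma travels_take:
  assumes "travels P A t vs"
  shows "travels P A t (take (Suc k) vs)"
proof -
  have "successively (\<lambda>a b. (a, b) \<in> route_arcs P A t) (take (Suc k) vs @ drop (Suc k) vs)"
    using assms by (simp add: travels_def)
  then show ?thesis
    using assms unfolding travels_def successively_append_iff by (cases vs) auto
qed

end

theorem theorem2:
  fixes P :: "('v, 't, 'r) pd_instance"
    and A :: "('v, 't, 'r) pd_assignment"
  assumes "pd_wf P"
    and "feasible P A"
  shows "\<forall>t\<in>trucks P. capacity_respected P A t"
proof
  fix t
  assume "t \<in> trucks P"
  then interpret feasible_truck P A t
    using assms by unfold_locales
  show "capacity_respected P A t"
    unfolding capacity_respected_def using travel_carried travels_take by blast
qed

end
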